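(* Let $G$ be an Abelian group and let $(a_n)_{n\in\omega}$ be a non-trivial $T$-sequence on $G$. Then the coarse group $(G,\mathcal{I}_{(a_n)})$ contains a subspace asymorphic to the Hamming space $\mathbb{H}$, and so $\mathrm{asdim}\,(G,\mathcal{I}_{(a_n)})=\infty$.
   Context: A coarse structure on a set $X$ is a family $\mathcal{E}$ of subsets of $X\times X$ such that: each $E\in\mathcal{E}$ contains the diagonal $\triangle_X$; $E,E'\in\mathcal{E}$ implies $E\circ E'\in\mathcal{E}$ and $E^{-1}\in\mathcal{E}$, where $E\circ E'=\{(x,y): \exists z\in X,\ (x,z)\in E,\ (z,y)\in E'\}$ and $E^{-1}=\{(y,x):(x,y)\in E\}$; if $E\in\mathcal{E}$ and $\triangle_X\subseteq E'\subseteq E$ then $E'\in\mathcal{E}$; for all $x,y\in X$ there is $E\in\mathcal{E}$ with $(x,y)\in E$. The pair $(X,\mathcal{E})$ is a coarse space. A subfamily $\mathcal{E}'\subseteq\mathcal{E}$ is a base for $\mathcal{E}$ if every $E\in\mathcal{E}$ is contained in some $E'\in\mathcal{E}'$. Write $E[x]=\{y\in X:(x,y)\in E\}$. A subset $Y\subseteq X$ is a subspace with the coarse structure $\{E\cap(Y\times Y):E\in\mathcal{E}\}$. A map $f:X\to X'$ between coarse spaces $(X,\mathcal{E})$, $(X',\mathcal{E}')$ is macro-uniform if for every $E\in\mathcal{E}$ there is $E'\in\mathcal{E}'$ such that $f(E[x])\subseteq E'[f(x)]$ for each $x\in X$. An asymorphism is a bijection $f$ such that $f$ and $f^{-1}$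 are macro-uniform; two coarse spaces are asymorphic if there is an asymorphism between them. A sequence $(a_n)_{n\in\omega}$ in an Abelian group $G$ is a $T$-sequence if there exists a Hausdorff group topology on $G$ in which $(a_n)$ converges to $0$; $\tau_{(a_n)}$ denotes the strongest group topology on $G$ in which $(a_n)$ converges to $0$. A $T$-sequence is trivial if $a_n=0$ for all but finitely many $n\in\omega$, and non-trivial otherwise. $\mathcal{I}_{(a_n)}$ is the ideal of all precompact (equivalently, by completeness of $(G,\tau_{(a_n)})$, totally bounded) subsets of $(G,\tau_{(a_n)})$. The coarse group $(G,\mathcal{I}_{(a_n)})$ is $G$ with the coarse structure having as base of entourages the sets $\{(x,y)\in G\times G: x-y\in P\}$, $P\in\mathcal{I}_{(a_n)}$ with $0\in P$. The Hamming space $\mathbb{H}$ is the set of all finite subsets of $\omega$ with the metric $h(F,H)=|F\triangle H|$, regarded as a coarse space with base of entourages $\{(F,H): h(F,H)\le n\}$, $n\in\omega$. Asymptotic dimension: for a coarse space $(X,\mathcal{E})$, $\mathrm{asdim}(X,\mathcal{E})\le n$ if for every $E\in\mathcal{E}$ there are $D\in\mathcal{E}$ and a cover $\mathcal{U}=\mathcal{U}_0\cup\dots\cup\mathcal{U}_n$ of $X$ such that $U\times U\subseteq D$ for each $U\in\mathcal{U}$, and, for each $i$, $(U\times V)\cap E=\emptyset$ for all distinct $U,V\in\mathcal{U}_i$. $\mathrm{asdim}(X,\mathcal{E})$ is the least such $n$, and $\infty$ if there is no such $n$. *)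

theory Defs
  imports "HOL-Analysis.Analysis"
begin

section \<open>Coarse spaces\<close>

text \<open>Coarse spaces have explicit carriers, so that subspaces are available. The composition
  of entourages is relational composition, and \<^term>\<open>E `` {x}\<close> is the ball of radius \<^term>\<open>E\<close>
  around \<^term>\<open>x\<close>.\<close>

definition coarse_structure :: "'a set \<Rightarrow> 'a rel set \<Rightarrow> bool" where
  "coarse_structure X \<E> \<longleftrightarrow>
     (\<forall>E\<in>\<E>. Id_on X \<subseteq> E \<and> E \<subseteq> X \<times> X) \<and>
     (\<forall>E\<in>\<E>. \<forall>E'\<in>\<E>. E O E' \<in> \<E>) \<and>
     (\<forall>E\<in>\<E>. E\<inverse> \<in> \<E>) \<and>
     (\<forall>E\<in>\<E>. \<forall>E'. Id_on X \<subseteq> E' \<and> E' \<subseteq> E \<longrightarrow> E' \<in> \<E>) \<and>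
     (\<forall>x\<in>X. \<forall>y\<in>X. \<exists>E\<in>\<E>. (x, y) \<in> E)"

definition is_coarse_base :: "'a rel set \<Rightarrow> 'a rel set \<Rightarrow> bool" where
  "is_coarse_base \<B> \<E> \<longleftrightarrow> \<B> \<subseteq> \<E> \<and> (\<forall>E\<in>\<E>. \<exists>B\<in>\<B>. E \<subseteq> B)"

definition coarse_from_base :: "'a set \<Rightarrow> 'a rel set \<Rightarrow> 'a rel set" where
  "coarse_from_base X \<B> = {E. Id_on X \<subseteq> E \<and> (\<exists>B\<in>\<B>. E \<subseteq> B)}"

definition subspace_coarse :: "'a rel set \<Rightarrow> 'a set \<Rightarrow> 'a rel set" where
  "subspace_coarse \<E> Y = {E \<inter> (Y \<times> Y) | E. E \<in> \<E>}"

definition macro_uniform ::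
  "'a set \<Rightarrow> 'a rel set \<Rightarrow> 'b set \<Rightarrow> 'b rel set \<Rightarrow> ('a \<Rightarrow> 'b) \<Rightarrow> bool" where
  "macro_uniform X \<E> X' \<E>' f \<longleftrightarrow>
     f \<in> X \<rightarrow> X' \<and> (\<forall>E\<in>\<E>. \<exists>E'\<in>\<E>'. \<forall>x\<in>X. f ` (E `` {x}) \<subseteq> E' `` {f x})"

definition asymorphism ::
  "'a set \<Rightarrow> 'a rel set \<Rightarrow> 'b set \<Rightarrow> 'b rel set \<Rightarrow> ('a \<Rightarrow> 'b) \<Rightarrow> bool" where
  "asymorphism X \<E> X' \<E>' f \<longleftrightarrow>
     bij_betw f X X' \<and> macro_uniform X \<E> X' \<E>' f \<and>
     macro_uniform X' \<E>' X \<E> (inv_into X f)"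

definition asymorphic ::
  "'a set \<Rightarrow> 'a rel set \<Rightarrow> 'b set \<Rightarrow> 'b rel set \<Rightarrow> bool" where
  "asymorphic X \<E> X' \<E>' \<longleftrightarrow> (\<exists>f. asymorphism X \<E> X' \<E>' f)"

text \<open>The cover is the union of the families \<^term>\<open>\<U> i\<close> for \<^term>\<open>i \<le> n\<close>; values of
  \<^term>\<open>\<U>\<close> beyond \<^term>\<open>n\<close> are irrelevant.\<close>

definition asdim_le :: "'a set \<Rightarrow> 'a rel set \<Rightarrow> nat \<Rightarrow> bool" where
  "asdim_le X \<E> n \<longleftrightarrow>
     (\<forall>E\<in>\<E>. \<exists>D\<in>\<E>. \<exists>\<U> :: nat \<Rightarrow> 'a set set.
        (\<Union>i\<le>n. \<Union>(\<U> i)) = X \<and>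
        (\<forall>i\<le>n. \<forall>U\<in>\<U> i. U \<times> U \<subseteq> D) \<and>
        (\<forall>i\<le>n. \<forall>U\<in>\<U> i. \<forall>V\<in>\<U> i. U \<noteq> V \<longrightarrow> (U \<times> V) \<inter> E = {}))"

definition asdim :: "'a set \<Rightarrow> 'a rel set \<Rightarrow> enat" where
  "asdim X \<E> =
     (if \<exists>n. asdim_le X \<E> n then enat (LEAST n. asdim_le X \<E> n) else \<infinity>)"

lemma coarse_structure_from_base:
  assumes "\<And>B. B \<in> \<B> \<Longrightarrow> Id_on X \<subseteq> B \<and> B \<subseteq> X \<times> X"
    and "\<And>B B'. B \<in> \<B> \<Longrightarrow> B' \<in> \<B> \<Longrightarrow> \<exists>C\<in>\<B>. B O B' \<subseteq> C"
    and "\<And>B. B \<in> \<B> \<Longrightarrow> \<exists>C\<in>\<B>. B\<inverse> \<subseteq> C"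
    and "\<And>x y. x \<in> X \<Longrightarrow> y \<in> X \<Longrightarrow> \<exists>B\<in>\<B>. (x, y) \<in> B"
  shows "coarse_structure X (coarse_from_base X \<B>)"
    and "is_coarse_base \<B> (coarse_from_base X \<B>)"
proof -
  show "is_coarse_base \<B> (coarse_from_base X \<B>)"
    using assms(1) by (auto simp: is_coarse_base_def coarse_from_base_def)
  have 1: "Id_on X \<subseteq> E \<and> E \<subseteq> X \<times> X" if "E \<in> coarse_from_base X \<B>" for E
    using that assms(1) by (fastforce simp: coarse_from_base_def)
  have 2: "E O E' \<in> coarse_from_base X \<B>"
    if E: "E \<in> coarse_from_base X \<B>" and E': "E' \<in> coarse_from_base X \<B>" for E E'
  proof -
    obtain B B' where B: "B \<in> \<B>" "E \<subseteq> B" "B' \<in> \<B>" "E' \<subseteq> B'"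
      using E E' by (auto simp: coarse_from_base_def)
    then obtain C where "C \<in> \<B>" "B O B' \<subseteq> C" using assms(2) by blast
    moreover have "E O E' \<subseteq> B O B'" using B by blast
    moreover have "Id_on X \<subseteq> E O E'"
    proof -
      have "Id_on X \<subseteq> E" "Id_on X \<subseteq> E'"
        using E E' by (auto simp: coarse_from_base_def)
      then have "(x, x) \<in> E O E'" if "x \<in> X" for x
        using that by blast
      then show ?thesis by auto
    qed
    ultimately show ?thesis by (auto simp: coarse_from_base_def)
  qed
  have 3: "E\<inverse> \<in> coarse_from_base X \<B>" if E: "E \<in> coarse_from_base X \<B>" for E
  proof -
    obtain B where B: "B \<in> \<B>" "E \<subseteq> B"
      using E by (auto simp: coarse_from_base_def)
    then obtain C where "C \<in> \<B>" "B\<inverse> \<subseteq> C" using assms(3) by blast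
    moreover have "E\<inverse> \<subseteq> B\<inverse>" using B by blast
    moreover have "Id_on X \<subseteq> E\<inverse>" using E by (auto simp: coarse_from_base_def Id_on_def)
    ultimately show ?thesis by (auto simp: coarse_from_base_def)
  qed
  have 4: "E' \<in> coarse_from_base X \<B>"
    if "E \<in> coarse_from_base X \<B>" "Id_on X \<subseteq> E'" "E' \<subseteq> E" for E E'
    using that unfolding coarse_from_base_def mem_Collect_eq by (meson order_trans)
  have 5: "\<exists>E\<in>coarse_from_base X \<B>. (x, y) \<in> E" if xy: "x \<in> X" "y \<in> X" for x y
  proof -
    obtain B where "B \<in> \<B>" "(x, y) \<in> B" using assms(4)[OF xy] by blast
    moreover then have "B \<in> coarse_from_base X \<B>"
      using assms(1) unfolding coarse_from_base_def by blast
    ultimately show ?thesis by blast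
  qed
  show "coarse_structure X (coarse_from_base X \<B>)"
    unfolding coarse_structure_def
    by (intro conjI ballI allI impI; (elim conjE)?;
        rule 1[THEN conjunct1] 1[THEN conjunct2] 2 3 4 5; assumption)
qed

section \<open>The Hamming space\<close>

definition hamming_dist :: "nat set \<Rightarrow> nat set \<Rightarrow> nat" where
  "hamming_dist F H = card (sym_diff F H)"

definition hamming_space :: "nat set set" where
  "hamming_space = {F. finite F}"

definition hamming_base :: "nat set rel set" where
  "hamming_base =
     {{(F, H). F \<in> hamming_space \<and> H \<in> hamming_space \<and> hamming_dist F H \<le> n} | n. True}"

definition hamming_coarse :: "nat set rel set" where
  "hamming_coarse = coarse_from_base hamming_space hamming_base"

lemma hamming_dist_triangle:
  assumes "finite F" "finite G" "finite H"
  shows "hamming_dist F H \<le> hamming_dist F G + hamming_dist G H"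
proof -
  have "card (sym_diff F H) \<le> card (sym_diff F G \<union> sym_diff G H)"
    using assms by (intro card_mono) auto
  also have "\<dots> \<le> card (sym_diff F G) + card (sym_diff G H)"
    by (rule card_Un_le)
  finally show ?thesis by (simp add: hamming_dist_def)
qed

lemma hamming_coarse_structure:
  "coarse_structure hamming_space hamming_coarse" "is_coarse_base hamming_base hamming_coarse"
proof -
  define B where
    "B n = {(F, H). F \<in> hamming_space \<and> H \<in> hamming_space \<and> hamming_dist F H \<le> n}" for n
  have B: "hamming_base = range B" by (auto simp: hamming_base_def B_def)
  have 1: "Id_on hamming_space \<subseteq> B n \<and> B n \<subseteq> hamming_space \<times> hamming_space" for n
    by (auto simp: B_def hamming_dist_def)
  have 2: "B m O B n \<subseteq> B (m + n)" for m n
  proof (clarsimp simp: B_def)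
    fix F G H
    assume *: "F \<in> hamming_space" "G \<in> hamming_space" "H \<in> hamming_space"
      "hamming_dist F G \<le> m" "hamming_dist G H \<le> n"
    then show "hamming_dist F H \<le> m + n"
      using hamming_dist_triangle[of F G H] by (auto simp: hamming_space_def)
  qed
  have 3: "(B n)\<inverse> \<subseteq> B n" for n
    by (auto simp: B_def hamming_dist_def) (simp add: Un_commute)
  have 4: "\<exists>n. (F, H) \<in> B n" if "F \<in> hamming_space" "H \<in> hamming_space" for F H
    using that by (auto simp: B_def)
  have 2: "\<exists>C\<in>range B. E O E' \<subseteq> C" if "E \<in> range B" "E' \<in> range B" for E E'
    using that 2 by (metis imageE rangeI)
  have 3: "\<exists>C\<in>range B. E\<inverse> \<subseteq> C" if "E \<in> range B" for E
    using that 3 by (metis imageE rangeI)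
  have 4: "\<exists>E\<in>range B. (F, H) \<in> E" if "F \<in> hamming_space" "H \<in> hamming_space" for F H
    using 4[OF that] by simp
  have 1: "Id_on hamming_space \<subseteq> E \<and> E \<subseteq> hamming_space \<times> hamming_space" if "E \<in> range B" for E
    using that 1 by (metis imageE)
  show "coarse_structure hamming_space hamming_coarse" "is_coarse_base hamming_base hamming_coarse"
    unfolding hamming_coarse_def B
    by (rule coarse_structure_from_base; (rule 1 2 3 4; assumption))+
qed

section \<open>T-sequences\<close>

definition group_topology :: "'a::ab_group_add topology \<Rightarrow> bool" where
  "group_topology T \<longleftrightarrow>
     topspace T = UNIV \<and>
     continuous_map (prod_topology T T) T (\<lambda>(x, y). x + y) \<and>
     continuous_map T T uminus"

definition T_sequence :: "(nat \<Rightarrow> 'a::ab_group_add) \<Rightarrow> bool" where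
  "T_sequence a \<longleftrightarrow>
     (\<exists>T. group_topology T \<and> Hausdorff_space T \<and> limitin T a 0 sequentially)"

definition trivial_seq :: "(nat \<Rightarrow> 'a::ab_group_add) \<Rightarrow> bool" where
  "trivial_seq a \<longleftrightarrow> finite {n. a n \<noteq> 0}"

definition strongest_group_topology ::
  "(nat \<Rightarrow> 'a::ab_group_add) \<Rightarrow> 'a topology \<Rightarrow> bool" where
  "strongest_group_topology a T \<longleftrightarrow>
     group_topology T \<and> limitin T a 0 sequentially \<and>
     (\<forall>T'. group_topology T' \<and> limitin T' a 0 sequentially \<longrightarrow>
           (\<forall>U. openin T' U \<longrightarrow> openin T U))"

definition seq_topology :: "(nat \<Rightarrow> 'a::ab_group_add) \<Rightarrow> 'a topology" where
  "seq_topology a = (THE T. strongest_group_topology a T)"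

text \<open>The topology generated by the union of all the admissible topologies is the strongest one.
  The indiscrete topology is always admissible, so no hypothesis on the sequence is needed.\<close>

lemma strongest_group_topology_exists: "\<exists>T. strongest_group_topology a T"
proof -
  define \<S> where
    "\<S> = {U. \<exists>T. group_topology T \<and> limitin T a 0 sequentially \<and> openin T U}"
  define S where "S = topology_generated_by \<S>"
  let ?I = "topology (\<lambda>U. U = {} \<or> U = (UNIV :: 'a set))"
  have "istopology (\<lambda>U. U = {} \<or> U = (UNIV :: 'a set))"
    by (auto simp: istopology_def)
  then have openI: "openin ?I U \<longleftrightarrow> U = {} \<or> U = UNIV" for U
    by (simp add: topology_inverse')
  have topI: "topspace ?I = UNIV"
    by (metis UNIV_I openI openin_subset subsetI subset_antisym)
  have "group_topology ?I" "limitin ?I a 0 sequentially"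
    using openin_topspace[of "prod_topology ?I ?I"]
    by (auto simp: group_topology_def continuous_map_def limitin_def openI topI)
  then have "UNIV \<in> \<S>"
    unfolding \<S>_def using openI by blast
  then have top: "topspace S = UNIV"
    unfolding S_def by auto
  have finer: "openin S U" if "group_topology T" "limitin T a 0 sequentially" "openin T U" for T U
    unfolding S_def using that by (intro topology_generated_by_Basis) (auto simp: \<S>_def)
  have lim: "limitin S a 0 sequentially"
    unfolding limitin_def
  proof (intro conjI allI impI)
    show "0 \<in> topspace S" by (simp add: top)
    fix U assume U: "openin S U \<and> 0 \<in> U"
    then have "generate_topology_on \<S> U"
      by (simp add: S_def openin_topology_generated_by)
    then have "0 \<in> U \<longrightarrow> (\<forall>\<^sub>F n in sequentially. a n \<in> U)"
    proof induct
      case (Int A B)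
      then show ?case by (auto intro: eventually_conj)
    next
      case (UN K)
      show ?case
      proof
        assume "0 \<in> \<Union> K"
        then obtain k where k: "k \<in> K" "0 \<in> k" by blast
        then have "\<forall>\<^sub>F n in sequentially. a n \<in> k" using UN by blast
        then show "\<forall>\<^sub>F n in sequentially. a n \<in> \<Union> K"
          by (rule eventually_mono) (use k in blast)
      qed
    next
      case (Basis A)
      then show ?case by (auto simp: \<S>_def limitin_def)
    qed auto
    then show "\<forall>\<^sub>F n in sequentially. a n \<in> U" using U by simp
  qed
  have neg: "continuous_map S S uminus"
    unfolding S_def
  proof (rule continuous_on_generated_topo)
    show "uminus ` topspace (topology_generated_by \<S>) \<subseteq> \<Union> \<S>"
      using \<open>UNIV \<in> \<S>\<close> by blast
    fix U assume "U \<in> \<S>"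
    then obtain T where T: "group_topology T" "limitin T a 0 sequentially" "openin T U"
      by (auto simp: \<S>_def)
    then have "openin T {x \<in> topspace T. - x \<in> U}"
      by (intro openin_continuous_map_preimage) (auto simp: group_topology_def)
    then have "openin S {x \<in> topspace T. - x \<in> U}" using T finer by blast
    moreover have "{x \<in> topspace T. - x \<in> U} = uminus -` U \<inter> topspace S"
      using T top by (auto simp: group_topology_def)
    ultimately show "openin (topology_generated_by \<S>)
        (uminus -` U \<inter> topspace (topology_generated_by \<S>))"
      by (simp add: S_def)
  qed
  have add: "continuous_map (prod_topology S S) S (\<lambda>(x, y). x + y)"
    unfolding S_def
  proof (rule continuous_on_generated_topo, fold S_def)
    show "(\<lambda>(x, y). x + y) ` topspace (prod_topology S S) \<subseteq> \<Union> \<S>"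
      using \<open>UNIV \<in> \<S>\<close> by blast
    fix U assume "U \<in> \<S>"
    then obtain T where T: "group_topology T" "limitin T a 0 sequentially" "openin T U"
      by (auto simp: \<S>_def)
    then have *: "openin (prod_topology T T)
        {p \<in> topspace (prod_topology T T). (\<lambda>(x, y). x + y) p \<in> U}"
      by (intro openin_continuous_map_preimage) (auto simp: group_topology_def)
    have id: "continuous_map S T (\<lambda>x. x)"
      using T finer top by (auto simp: continuous_map_def group_topology_def)
    have "continuous_map (prod_topology S S) (prod_topology T T) (\<lambda>p. (fst p, snd p))"
      by (intro continuous_map_pairedI continuous_map_compose[OF continuous_map_fst id, unfolded o_def]
          continuous_map_compose[OF continuous_map_snd id, unfolded o_def])
    from openin_continuous_map_preimage[OF this *]
    show "openin (prod_topology S S) ((\<lambda>(x, y). x + y) -` U \<inter> topspace (prod_topology S S))"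
      using T(1) by (simp add: group_topology_def top vimage_def case_prod_beta)
  qed
  have "strongest_group_topology a S"
    unfolding strongest_group_topology_def group_topology_def[of S]
    using top add neg lim finer by blast
  then show ?thesis ..
qed

lemma strongest_group_topology_unique:
  assumes "strongest_group_topology a T" "strongest_group_topology a T'"
  shows "T = T'"
  using assms unfolding strongest_group_topology_def topology_eq by blast

lemma seq_topology: "strongest_group_topology a (seq_topology a)"
proof -
  obtain T where T: "strongest_group_topology a T"
    using strongest_group_topology_exists by blast
  then show ?thesis
    unfolding seq_topology_def by (rule theI) (rule strongest_group_topology_unique[OF _ T])
qed

lemma Hausdorff_seq_topology:
  assumes "T_sequence a"
  shows "Hausdorff_space (seq_topology a)"
proof -
  obtain T where T: "group_topology T" "Hausdorff_space T" "limitin T a 0 sequentially"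
    using assms by (auto simp: T_sequence_def)
  then have fine: "openin (seq_topology a) U" if "openin T U" for U
    using that seq_topology[of a] by (auto simp: strongest_group_topology_def)
  have top: "topspace T = UNIV"
    using T by (simp add: group_topology_def)
  show ?thesis
    unfolding Hausdorff_space_def
  proof (intro allI impI)
    fix x y assume "x \<in> topspace (seq_topology a) \<and> y \<in> topspace (seq_topology a) \<and> x \<noteq> y"
    then obtain U V where "openin T U" "openin T V" "x \<in> U" "y \<in> V" "disjnt U V"
      using T(2) top unfolding Hausdorff_space_def by (metis UNIV_I)
    then show "\<exists>U V. openin (seq_topology a) U \<and> openin (seq_topology a) V \<and>
        x \<in> U \<and> y \<in> V \<and> disjnt U V"
      using fine by blast
  qed
qed

section \<open>The coarse group of a T-sequence\<close>

text \<open>Precompact means relatively compact here; the usage as a synonym for totally bounded agrees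
  with it for \<^term>\<open>seq_topology a\<close>, by completeness.\<close>

definition precompact_in :: "'a topology \<Rightarrow> 'a set \<Rightarrow> bool" where
  "precompact_in T P \<longleftrightarrow> P \<subseteq> topspace T \<and> compactin T (T closure_of P)"

definition seq_ideal :: "(nat \<Rightarrow> 'a::ab_group_add) \<Rightarrow> 'a set set" where
  "seq_ideal a = {P. precompact_in (seq_topology a) P}"

definition ideal_base :: "'a::ab_group_add set set \<Rightarrow> 'a rel set" where
  "ideal_base \<I> = {{(x, y). x - y \<in> P} | P. P \<in> \<I> \<and> 0 \<in> P}"

definition ideal_coarse :: "'a::ab_group_add set set \<Rightarrow> 'a rel set" where
  "ideal_coarse \<I> = coarse_from_base UNIV (ideal_base \<I>)"

lemma ideal_coarse_structure:
  assumes "T_sequence a"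
  shows "coarse_structure UNIV (ideal_coarse (seq_ideal a))"
    and "is_coarse_base (ideal_base (seq_ideal a)) (ideal_coarse (seq_ideal a))"
proof -
  let ?T = "seq_topology a"
  have H: "Hausdorff_space ?T" by (rule Hausdorff_seq_topology[OF assms])
  have G: "topspace ?T = UNIV" "continuous_map (prod_topology ?T ?T) ?T (\<lambda>(x, y). x + y)"
    "continuous_map ?T ?T uminus"
    using seq_topology[of a] by (auto simp: strongest_group_topology_def group_topology_def)
  have sub: "P \<in> seq_ideal a" if "compactin ?T K" "P \<subseteq> K" for P K
  proof -
    have "closedin ?T K" using H that(1) by (rule compactin_imp_closedin)
    then have "?T closure_of P \<subseteq> K" using that(2) by (rule closure_of_minimal[rotated])
    then have "compactin ?T (?T closure_of P)"
      using that(1) by (meson closed_compactin closedin_closure_of)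
    then show ?thesis by (simp add: seq_ideal_def precompact_in_def G)
  qed
  have cl: "compactin ?T (?T closure_of P)" "P \<subseteq> ?T closure_of P" if "P \<in> seq_ideal a" for P
    using that by (auto simp: seq_ideal_def precompact_in_def G closure_of_subset)
  have add: "{x + y | x y. x \<in> P \<and> y \<in> Q} \<in> seq_ideal a"
    if PQ: "P \<in> seq_ideal a" "Q \<in> seq_ideal a" for P Q
  proof (rule sub)
    show "compactin ?T ((\<lambda>(x, y). x + y) ` ((?T closure_of P) \<times> (?T closure_of Q)))"
      using cl PQ by (intro image_compactin[OF _ G(2)]) (simp add: compactin_Times)
    show "{x + y | x y. x \<in> P \<and> y \<in> Q}
        \<subseteq> (\<lambda>(x, y). x + y) ` ((?T closure_of P) \<times> (?T closure_of Q))"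
      using cl(2)[OF PQ(1)] cl(2)[OF PQ(2)] by force
  qed
  have neg: "uminus ` P \<in> seq_ideal a" if "P \<in> seq_ideal a" for P
    using cl[OF that] by (intro sub[OF image_compactin[OF _ G(3)]] image_mono)
  have fin: "P \<in> seq_ideal a" if "finite P" for P
    using that by (intro sub[of P]) (auto simp: G finite_imp_compactin)
  have 1: "Id_on UNIV \<subseteq> B \<and> B \<subseteq> UNIV \<times> UNIV" if "B \<in> ideal_base (seq_ideal a)" for B
    using that by (auto simp: ideal_base_def)
  have 2: "\<exists>C\<in>ideal_base (seq_ideal a). B O B' \<subseteq> C"
    if B: "B \<in> ideal_base (seq_ideal a)" "B' \<in> ideal_base (seq_ideal a)" for B B'
  proof -
    obtain P Q where P: "P \<in> seq_ideal a" "0 \<in> P" "B = {(x, y). x - y \<in> P}"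
      and Q: "Q \<in> seq_ideal a" "0 \<in> Q" "B' = {(x, y). x - y \<in> Q}"
      using B by (auto simp: ideal_base_def)
    let ?R = "{x + y | x y. x \<in> P \<and> y \<in> Q}"
    have "0 \<in> ?R" using P(2) Q(2) by force
    then have "{(x, y). x - y \<in> ?R} \<in> ideal_base (seq_ideal a)"
      using add[OF P(1) Q(1)] unfolding ideal_base_def by blast
    moreover have "B O B' \<subseteq> {(x, y). x - y \<in> ?R}"
    proof clarify
      fix x y z assume "(x, y) \<in> B" "(y, z) \<in> B'"
      then show "\<exists>u v. x - z = u + v \<and> u \<in> P \<and> v \<in> Q"
        using P(3) Q(3) by (intro exI[of _ "x - y"] exI[of _ "y - z"]) auto
    qed
    ultimately show ?thesis by blast
  qed
  have 3: "\<exists>C\<in>ideal_base (seq_ideal a). B\<inverse> \<subseteq> C" if B: "B \<in> ideal_base (seq_ideal a)" for B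
  proof -
    obtain P where P: "P \<in> seq_ideal a" "0 \<in> P" "B = {(x, y). x - y \<in> P}"
      using B by (auto simp: ideal_base_def)
    have "0 \<in> uminus ` P" using P(2) by force
    then have "{(x, y). x - y \<in> uminus ` P} \<in> ideal_base (seq_ideal a)"
      using neg[OF P(1)] unfolding ideal_base_def by blast
    moreover have "B\<inverse> \<subseteq> {(x, y). x - y \<in> uminus ` P}"
      using P(3) by (auto simp: image_iff) (metis minus_diff_eq)
    ultimately show ?thesis by blast
  qed
  have 4: "\<exists>B\<in>ideal_base (seq_ideal a). (x, y) \<in> B" for x y
  proof -
    have "{(u, v). u - v \<in> {0, x - y}} \<in> ideal_base (seq_ideal a)"
      using fin[of "{0, x - y}"] unfolding ideal_base_def by blast
    then show ?thesis by (rule rev_bexI) simp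
  qed
  show "coarse_structure UNIV (ideal_coarse (seq_ideal a))"
    "is_coarse_base (ideal_base (seq_ideal a)) (ideal_coarse (seq_ideal a))"
    unfolding ideal_coarse_def
    by (rule coarse_structure_from_base; (rule 1 2 3 4; assumption?))+
qed

end

theory Submission
  imports Defs "HOL-Library.Ramsey"
begin

text \<open>Let \<open>A n\<close> be the set of sums of at most \<open>n\<close> elements \<open>\<plusminus>a i\<close>. It is compact, hence closed, and
  if \<open>s \<notin> A n\<close>, then \<open>s \<plusminus> a m \<notin> A (n + 1)\<close> for all large \<open>m\<close> with \<open>a m \<noteq> 0\<close>. Choosing a subsequence
  \<open>b\<close> greedily, the signed sums of \<open>r\<close> distinct terms of \<open>b\<close> thus have word length exactly \<open>r\<close>, so
  \<open>F \<mapsto> (\<Sum>i\<in>F. b i)\<close> turns the Hamming distance into word length. This is an asymorphism onto its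
  image because word length is bounded on every compact set of words: otherwise there are \<open>x k\<close>
  in the compact set with \<open>x k - x j \<notin> A k\<close> for \<open>j < k\<close>, and one builds a neighbourhood of zero
  containing none of these differences, contradicting total boundedness.

  For the asymptotic dimension, a cover of finitely many colours induces a colouring of the
  \<open>k\<close>-subsets of \<open>\<omega>\<close>, and Ramsey's theorem yields an infinite set all of whose \<open>k\<close>-subsets have the
  same colour. Exchanging one element at a time connects two disjoint \<open>k\<close>-subsets by steps of length
  2, so a single member of the cover has diameter at least \<open>2 * k\<close>, with \<open>k\<close> arbitrary.\<close>

section \<open>Neighbourhood bases of group topologies\<close>

text \<open>A set is declared open if it contains, around each of its points, a translate of a
  member of \<open>\<B>\<close>. Members of \<open>\<B>\<close> need not be open themselves, which
  is why the last conclusion provides open sets inside them.\<close>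

lemma group_topology_from_base:
  fixes \<B> :: "'a::ab_group_add set set"
  assumes ne: "\<B> \<noteq> {}"
    and zero: "\<And>U. U \<in> \<B> \<Longrightarrow> 0 \<in> U"
    and inter: "\<And>U V. U \<in> \<B> \<Longrightarrow> V \<in> \<B> \<Longrightarrow> \<exists>W\<in>\<B>. W \<subseteq> U \<inter> V"
    and add: "\<And>U. U \<in> \<B> \<Longrightarrow> \<exists>V\<in>\<B>. V + V \<subseteq> U"
    and neg: "\<And>U. U \<in> \<B> \<Longrightarrow> \<exists>V\<in>\<B>. uminus ` V \<subseteq> U"
  obtains T where "group_topology T"
    and "\<And>W. openin T W \<longleftrightarrow> (\<forall>x\<in>W. \<exists>U\<in>\<B>. (+) x ` U \<subseteq> W)"
    and "\<And>U. U \<in> \<B> \<Longrightarrow> \<exists>W. openin T W \<and> 0 \<in> W \<and> W \<subseteq> U"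
proof -
  define nhd where "nhd x S \<longleftrightarrow> (\<exists>U\<in>\<B>. (+) x ` U \<subseteq> S)" for x S
  define T where "T = topology (\<lambda>W. \<forall>x\<in>W. nhd x W)"
  have mono: "nhd x S \<Longrightarrow> S \<subseteq> S' \<Longrightarrow> nhd x S'" for x S S'
    unfolding nhd_def by blast
  have "istopology (\<lambda>W. \<forall>x\<in>W. nhd x W)"
    unfolding istopology_def
  proof (intro conjI allI impI ballI)
    fix S S' x assume S: "\<forall>x\<in>S. nhd x S" "\<forall>x\<in>S'. nhd x S'" and x: "x \<in> S \<inter> S'"
    then obtain U V where UV: "U \<in> \<B>" "V \<in> \<B>" "(+) x ` U \<subseteq> S" "(+) x ` V \<subseteq> S'"
      unfolding nhd_def by (meson IntE)
    then obtain W where W: "W \<in> \<B>" "W \<subseteq> U \<inter> V" using inter by meson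
    then have "(+) x ` W \<subseteq> S \<inter> S'" using UV by (blast intro: order_trans[OF image_mono])
    then show "nhd x (S \<inter> S')" using W(1) by (auto simp: nhd_def)
  next
    fix \<K> x assume "\<forall>K\<in>\<K>. \<forall>x\<in>K. nhd x K" "x \<in> \<Union> \<K>"
    then show "nhd x (\<Union> \<K>)" by (meson UnionE Union_upper mono)
  qed
  then have openT: "openin T W \<longleftrightarrow> (\<forall>x\<in>W. nhd x W)" for W
    by (simp add: T_def topology_inverse')
  have "openin T UNIV" using ne by (auto simp: openT nhd_def)
  then have top: "topspace T = UNIV" using openin_subset by blast
  \<comment> \<open>The witness \<open>{y. nhd y S}\<close> is the interior of \<open>S\<close>. It
    is open because, for \<open>V + V \<subseteq> U\<close>, moving a point by an element of
    \<open>V\<close> still leaves room for a translate of \<open>V\<close> inside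
    \<open>S\<close>.\<close>
  have int: "\<exists>W. openin T W \<and> x \<in> W \<and> W \<subseteq> S" if "nhd x S" for x S
  proof (intro exI conjI)
    show "x \<in> {y. nhd y S}" using that by simp
    show "{y. nhd y S} \<subseteq> S"
      unfolding nhd_def using zero by fastforce
    show "openin T {y. nhd y S}"
      unfolding openT
    proof (intro ballI, clarify)
      fix y assume "nhd y S"
      then obtain U where U: "U \<in> \<B>" "(+) y ` U \<subseteq> S" by (auto simp: nhd_def)
      then obtain V where V: "V \<in> \<B>" "V + V \<subseteq> U" using add by blast
      have "nhd (y + v) S" if "v \<in> V" for v
        unfolding nhd_def
      proof (intro bexI[OF _ V(1)] subsetI; clarify)
        fix w assume "w \<in> V"
        then have "v + w \<in> U" using V that by blast
        then show "y + v + w \<in> S" using U by (auto simp: add.assoc)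
      qed
      then show "nhd y {y. nhd y S}" unfolding nhd_def[of y "Collect _"] using V(1) by blast
    qed
  qed
  have "continuous_map T T uminus"
    unfolding continuous_map top
  proof (intro conjI allI impI)
    fix W assume W: "openin T W"
    show "openin T {x \<in> UNIV. - x \<in> W}"
      unfolding openT
    proof (intro ballI, clarify)
      fix x assume "- x \<in> W"
      then obtain U where U: "U \<in> \<B>" "(+) (- x) ` U \<subseteq> W" using W by (auto simp: openT nhd_def)
      then obtain V where V: "V \<in> \<B>" "uminus ` V \<subseteq> U" using neg by blast
      have "- (x + v) \<in> W" if "v \<in> V" for v
      proof -
        have "- x + (- v) \<in> W" using U V that by blast
        then show ?thesis by simp
      qed
      then show "nhd x {x \<in> UNIV. - x \<in> W}" unfolding nhd_def using V(1) by blast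
    qed
  qed simp
  moreover have "continuous_map (prod_topology T T) T (\<lambda>(x, y). x + y)"
    unfolding continuous_map topspace_prod_topology top
  proof (intro conjI allI impI)
    fix W assume W: "openin T W"
    show "openin (prod_topology T T) {p \<in> UNIV \<times> UNIV. (case p of (x, y) \<Rightarrow> x + y) \<in> W}"
      unfolding openin_prod_topology_alt
    proof (intro allI impI, clarify)
      fix x y assume "x + y \<in> W"
      then obtain U where U: "U \<in> \<B>" "(+) (x + y) ` U \<subseteq> W" using W by (auto simp: openT nhd_def)
      then obtain V where V: "V \<in> \<B>" "V + V \<subseteq> U" using add by blast
      obtain A where A: "openin T A" "x \<in> A" "A \<subseteq> (+) x ` V"
        using int[of x "(+) x ` V"] V(1) nhd_def by blast
      obtain B where B: "openin T B" "y \<in> B" "B \<subseteq> (+) y ` V"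
        using int[of y "(+) y ` V"] V(1) nhd_def by blast
      have "u + v \<in> W" if uv: "u \<in> A" "v \<in> B" for u v
      proof -
        obtain c d where cd: "c \<in> V" "d \<in> V" "u = x + c" "v = y + d" using uv A B by blast
        then have "(x + y) + (c + d) \<in> W" using U V by blast
        then show ?thesis using cd by (simp add: algebra_simps)
      qed
      then show "\<exists>A B. openin T A \<and> openin T B \<and> x \<in> A \<and> y \<in> B \<and>
          A \<times> B \<subseteq> {p \<in> UNIV \<times> UNIV. (case p of (x, y) \<Rightarrow> x + y) \<in> W}"
        using A B by (intro exI[of _ A] exI[of _ B]) auto
    qed
  qed simp
  ultimately have "group_topology T" by (simp add: group_topology_def top)
  moreover have "\<exists>W. openin T W \<and> 0 \<in> W \<and> W \<subseteq> U" if "U \<in> \<B>" for U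
    using int[of 0 U] that by (auto simp: nhd_def)
  ultimately show ?thesis using that openT by (simp add: nhd_def)
qed

section \<open>Sums of tails of the sequence\<close>

text \<open>Inserting the limit zero makes the tail compact; negatives make every set built from it
  symmetric.\<close>

definition null_tail :: "(nat \<Rightarrow> 'a::ab_group_add) \<Rightarrow> nat \<Rightarrow> 'a set" where
  "null_tail a m = insert 0 (a ` {m..} \<union> uminus ` a ` {m..})"

text \<open>Addition of sets is elementwise, so each summand has its own tail. Constant
  \<open>\<nu>\<close> gives balls of the word length, variable \<open>\<nu>\<close> gives
  neighbourhoods of zero.\<close>

definition tail_sums :: "(nat \<Rightarrow> 'a::ab_group_add) \<Rightarrow> (nat \<Rightarrow> nat) \<Rightarrow> nat \<Rightarrow> 'a set" where
  "tail_sums a \<nu> k = (\<Sum>i<k. null_tail a (\<nu> i))"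

abbreviation word_ball :: "(nat \<Rightarrow> 'a::ab_group_add) \<Rightarrow> nat \<Rightarrow> 'a set" where
  "word_ball a n \<equiv> tail_sums a (\<lambda>_. 0) n"

lemma zero_null_tail [simp]: "0 \<in> null_tail a m"
  by (simp add: null_tail_def)

lemma null_tail_antimono: "m \<le> n \<Longrightarrow> null_tail a n \<subseteq> null_tail a m"
  by (auto simp: null_tail_def)

lemma uminus_null_tail [simp]: "- x \<in> null_tail a m \<longleftrightarrow> x \<in> null_tail a m"
  by (auto simp: null_tail_def image_iff minus_equation_iff) (metis atLeast_iff minus_minus)+

lemma null_tail_0_split: "null_tail a 0 \<subseteq> (a ` {..<N} \<union> uminus ` a ` {..<N}) \<union> null_tail a N"
  by (auto simp: null_tail_def) (metis imageI lessThan_iff linorder_not_le atLeast_iff)+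

lemma tail_sums_0 [simp]: "tail_sums a \<nu> 0 = {0}"
  by (simp add: tail_sums_def)

lemma tail_sums_Suc: "tail_sums a \<nu> (Suc k) = tail_sums a \<nu> k + null_tail a (\<nu> k)"
  by (simp add: tail_sums_def)

lemma zero_tail_sums [simp]: "0 \<in> tail_sums a \<nu> k"
proof (induction k)
  case (Suc k)
  then have "0 + 0 \<in> tail_sums a \<nu> (Suc k)"
    unfolding tail_sums_Suc by (intro set_plus_intro) auto
  then show ?case by simp
qed simp

lemma tail_sums_SucI:
  "x \<in> tail_sums a \<nu> k \<Longrightarrow> y \<in> null_tail a (\<nu> k) \<Longrightarrow> x + y \<in> tail_sums a \<nu> (Suc k)"
  by (auto simp: tail_sums_Suc)

lemma tail_sums_SucE:
  assumes "z \<in> tail_sums a \<nu> (Suc k)"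
  obtains x y where "x \<in> tail_sums a \<nu> k" "y \<in> null_tail a (\<nu> k)" "z = x + y"
  using assms by (auto simp: tail_sums_Suc elim: set_plus_elim)

lemma tail_sums_mono: "k \<le> l \<Longrightarrow> tail_sums a \<nu> k \<subseteq> tail_sums a \<nu> l"
proof (induction rule: dec_induct)
  case (step l)
  have "x \<in> tail_sums a \<nu> (Suc l)" if "x \<in> tail_sums a \<nu> l" for x
    using tail_sums_SucI[OF that zero_null_tail] by simp
  then show ?case using step by blast
qed simp

lemma tail_sums_antimono: "(\<And>i. \<nu> i \<le> \<nu>' i) \<Longrightarrow> tail_sums a \<nu>' k \<subseteq> tail_sums a \<nu> k"
  by (induction k) (simp_all add: tail_sums_Suc set_plus_mono2 null_tail_antimono)

lemma uminus_tail_sums [simp]: "- x \<in> tail_sums a \<nu> k \<longleftrightarrow> x \<in> tail_sums a \<nu> k"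
proof -
  have "- x \<in> tail_sums a \<nu> k" if "x \<in> tail_sums a \<nu> k" for x
    using that
  proof (induction k arbitrary: x)
    case (Suc k)
    from Suc.prems obtain y z where "y \<in> tail_sums a \<nu> k" "z \<in> null_tail a (\<nu> k)" "x = y + z"
      by (rule tail_sums_SucE)
    then show ?case using tail_sums_SucI[of "- y" a \<nu> k "- z"] Suc.IH by simp
  qed simp
  from this this[of "- x"] show ?thesis by auto
qed

lemma word_ball_add: "word_ball a m + word_ball a n = word_ball a (m + n)"
  by (induction n) (simp_all add: tail_sums_Suc flip: add.assoc)

lemma word_ball_addI: "x \<in> word_ball a m \<Longrightarrow> y \<in> word_ball a n \<Longrightarrow> x + y \<in> word_ball a (m + n)"
  using word_ball_add by blast

lemma word_ball_diffI: "x \<in> word_ball a m \<Longrightarrow> y \<in> word_ball a n \<Longrightarrow> x - y \<in> word_ball a (m + n)"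
  using word_ball_addI[of x a m "- y" n] by simp

lemma sum_word_ball:
  assumes "finite F" "\<And>i. i \<in> F \<Longrightarrow> b i \<in> null_tail a 0"
  shows "sum b F \<in> word_ball a (card F)"
  using assms
proof (induction rule: finite_induct)
  case (insert i F)
  then show ?case using tail_sums_SucI[of "sum b F" a "\<lambda>_. 0" "card F" "b i"]
    by (simp add: add.commute)
qed simp

text \<open>The two copies of the tail at place \<open>i\<close> fit into the places
  \<open>2 * i\<close> and \<open>Suc (2 * i)\<close>. This yields the halving condition required of
  a neighbourhood base.\<close>

lemma tail_sums_double:
  assumes "\<And>i. \<nu> (2 * i) \<le> \<nu>' i" "\<And>i. \<nu> (Suc (2 * i)) \<le> \<nu>' i"
  shows "tail_sums a \<nu>' k + tail_sums a \<nu>' k \<subseteq> tail_sums a \<nu> (2 * k)"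
proof (induction k)
  case (Suc k)
  have "tail_sums a \<nu>' (Suc k) + tail_sums a \<nu>' (Suc k) =
      ((tail_sums a \<nu>' k + tail_sums a \<nu>' k) + null_tail a (\<nu>' k)) + null_tail a (\<nu>' k)"
    by (simp add: tail_sums_Suc ac_simps)
  also have "\<dots> \<subseteq> (tail_sums a \<nu> (2 * k) + null_tail a (\<nu> (2 * k))) + null_tail a (\<nu> (Suc (2 * k)))"
    using Suc assms by (intro set_plus_mono2 null_tail_antimono)
  finally show ?case by (simp add: tail_sums_Suc)
qed simp

text \<open>The sets \<^term>\<open>\<Union>k. tail_sums a \<nu> k\<close> are neighbourhoods of zero in some group topology in
  which the sequence converges to zero, hence also in the strongest such topology.\<close>

lemma UN_tail_sums_add:
  "\<exists>\<nu>'. (\<Union>k. tail_sums a \<nu>' k) + (\<Union>k. tail_sums a \<nu>' k) \<subseteq> (\<Union>k. tail_sums a \<nu> k)"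
proof (intro exI subsetI)
  let ?\<nu> = "\<lambda>i. max (\<nu> (2 * i)) (\<nu> (Suc (2 * i)))"
  fix z assume "z \<in> (\<Union>k. tail_sums a ?\<nu> k) + (\<Union>k. tail_sums a ?\<nu> k)"
  then obtain x y k l where z: "z = x + y" "x \<in> tail_sums a ?\<nu> k" "y \<in> tail_sums a ?\<nu> l"
    by (auto elim!: set_plus_elim)
  then have "x \<in> tail_sums a ?\<nu> (max k l)" "y \<in> tail_sums a ?\<nu> (max k l)"
    using tail_sums_mono[of k "max k l" a ?\<nu>] tail_sums_mono[of l "max k l" a ?\<nu>] by auto
  then have "z \<in> tail_sums a \<nu> (2 * max k l)"
    unfolding z(1) by (intro subsetD[OF tail_sums_double[of \<nu> ?\<nu>] set_plus_intro]) auto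
  then show "z \<in> (\<Union>k. tail_sums a \<nu> k)" by blast
qed

lemma UN_tail_sums_nhd:
  "\<exists>W. openin (seq_topology a) W \<and> 0 \<in> W \<and> W \<subseteq> (\<Union>k. tail_sums a \<nu> k)"
proof -
  define U where "U \<nu> = (\<Union>k. tail_sums a \<nu> k)" for \<nu>
  obtain T where T: "group_topology T"
    "\<And>W. openin T W \<longleftrightarrow> (\<forall>x\<in>W. \<exists>V\<in>range U. (+) x ` V \<subseteq> W)"
    "\<And>V. V \<in> range U \<Longrightarrow> \<exists>W. openin T W \<and> 0 \<in> W \<and> W \<subseteq> V"
  proof (rule group_topology_from_base[of "range U"])
    show "\<exists>W\<in>range U. W \<subseteq> V \<inter> V'" if V: "V \<in> range U" "V' \<in> range U" for V V'
    proof -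
      obtain \<nu> \<nu>' where "V = U \<nu>" "V' = U \<nu>'" using V by blast
      moreover have "U (\<lambda>i. max (\<nu> i) (\<nu>' i)) \<subseteq> U \<nu> \<inter> U \<nu>'"
        unfolding U_def by (intro Int_greatest UN_mono tail_sums_antimono) auto
      ultimately show ?thesis by blast
    qed
    show "\<exists>W\<in>range U. W + W \<subseteq> V" if "V \<in> range U" for V
      using that UN_tail_sums_add[of a] by (auto simp: U_def)
    show "\<exists>W\<in>range U. uminus ` W \<subseteq> V" if "V \<in> range U" for V
      using that by (intro bexI[OF _ that]) (auto simp: U_def)
  qed (auto simp: U_def)
  have "limitin T a 0 sequentially"
    unfolding limitin_def
  proof (intro conjI allI impI)
    show "0 \<in> topspace T" using T(1) by (simp add: group_topology_def)
    fix W assume "openin T W \<and> 0 \<in> W"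
    then obtain \<mu> where \<mu>: "U \<mu> \<subseteq> W" unfolding T(2) by auto
    \<comment> \<open>Convergence is visible from the first tail alone, which contains
      \<open>a n\<close> from index \<open>\<mu> 0\<close> on.\<close>
    have "a n \<in> W" if "n \<ge> \<mu> 0" for n
    proof -
      have "0 + a n \<in> tail_sums a \<mu> (Suc 0)"
        using that by (intro tail_sums_SucI) (auto simp: null_tail_def)
      then show ?thesis using \<mu> by (auto simp: U_def)
    qed
    then show "\<forall>\<^sub>F n in sequentially. a n \<in> W" by (auto simp: eventually_sequentially)
  qed
  then have "openin (seq_topology a) W" if "openin T W" for W
    using that T(1) seq_topology[of a] unfolding strongest_group_topology_def by blast
  then show ?thesis using T(3)[of "U \<nu>"] by (auto simp: U_def)
qed

section \<open>Compactness and word length in Hausdorff group topologies\<close>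

locale null_sequence =
  fixes T :: "'a::ab_group_add topology" and a :: "nat \<Rightarrow> 'a"
  assumes group: "group_topology T"
    and Hausdorff: "Hausdorff_space T"
    and lim: "limitin T a 0 sequentially"
begin

lemma topspace [simp]: "topspace T = UNIV"
  using group by (simp add: group_topology_def)

lemma continuous_uminus: "continuous_map T T uminus"
  using group by (simp add: group_topology_def)

lemma continuous_translation: "continuous_map T T (\<lambda>x. x + c)"
proof -
  have "continuous_map T (prod_topology T T) (\<lambda>x. (x, c))"
    by (intro continuous_map_pairedI) auto
  from continuous_map_compose[OF this, of T "\<lambda>(x, y). x + y"] show ?thesis
    using group by (simp add: group_topology_def o_def)
qed

lemma openin_translation: "openin T W \<Longrightarrow> openin T {x. x - c \<in> W}"
  using openin_continuous_map_preimage[OF continuous_translation[of "- c"]] by simp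

lemma compactin_set_plus:
  assumes "compactin T K" "compactin T L"
  shows "compactin T (K + L)"
  unfolding set_plus_image using assms group
  by (intro image_compactin[of "prod_topology T T"]) (auto simp: compactin_Times group_topology_def)

lemma compactin_null_tail: "compactin T (null_tail a m)"
proof -
  have "limitin T (uminus \<circ> a) (- 0) sequentially"
    by (rule continuous_map_limit[OF continuous_uminus lim])
  then have "compactin T (insert (- 0) (uminus ` a ` {m..}))"
    by (rule compactin_sequence_with_limit) auto
  moreover have "compactin T (insert 0 (a ` {m..}))"
    using lim by (rule compactin_sequence_with_limit) auto
  moreover have "null_tail a m = insert 0 (a ` {m..}) \<union> insert (- 0) (uminus ` a ` {m..})"
    by (auto simp: null_tail_def)
  ultimately show ?thesis by (metis compactin_Un)
qed

lemma compactin_tail_sums: "compactin T (tail_sums a \<nu> k)"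
  by (induction k) (simp_all add: tail_sums_Suc compactin_set_plus compactin_null_tail)

text \<open>Since \<open>C\<close> is closed, the \<open>x\<close> with
  \<open>y - x \<notin> C\<close> form a neighbourhood of zero, and so do their negatives. Hence
  both \<open>a n\<close> and \<open>- a n\<close> are such \<open>x\<close> for all large
  \<open>n\<close>.\<close>

lemma avoid_null_tail:
  assumes "compactin T C" "y \<notin> C"
  shows "\<exists>N. y \<notin> C + null_tail a N"
proof -
  let ?W = "{x. y - x \<notin> C}"
  have "closedin T C" using Hausdorff assms(1) by (rule compactin_imp_closedin)
  then have C: "openin T (- C)" by (simp add: closedin_def Compl_eq_Diff_UNIV)
  have "continuous_map T T (\<lambda>x. y - x)"
    using continuous_map_compose[OF continuous_uminus continuous_translation[of y]]
    by (simp add: o_def)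
  then have W: "openin T ?W"
    using openin_continuous_map_preimage[OF _ C] by force
  have "openin T {x. - x \<in> ?W}"
    using openin_continuous_map_preimage[OF continuous_uminus W] by simp
  with W have "\<forall>\<^sub>F n in sequentially. a n \<in> ?W \<and> - a n \<in> ?W"
    using lim assms(2) by (fastforce simp: limitin_def intro!: eventually_conj)
  then obtain N where "\<And>n. n \<ge> N \<Longrightarrow> a n \<in> ?W \<and> - a n \<in> ?W"
    by (auto simp: eventually_sequentially)
  then have N: "y - c \<notin> C" if "c \<in> null_tail a N" for c
    using that assms(2) by (auto simp: null_tail_def)
  have "y \<notin> C + null_tail a N"
  proof
    assume "y \<in> C + null_tail a N"
    then obtain x c where "x \<in> C" "c \<in> null_tail a N" "y = x + c" by (rule set_plus_elim)
    then show False using N[of c] by simp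
  qed
  then show ?thesis ..
qed

lemma avoid_null_tail_finite:
  assumes "compactin T C" "finite Y" "Y \<inter> C = {}"
  shows "\<exists>N. Y \<inter> (C + null_tail a N) = {}"
proof -
  have "\<forall>y\<in>Y. \<exists>N. y \<notin> C + null_tail a N"
    using avoid_null_tail[OF assms(1)] assms(3) by blast
  then obtain N where N: "\<And>y. y \<in> Y \<Longrightarrow> y \<notin> C + null_tail a (N y)" by metis
  have "y \<notin> C + null_tail a (Max (N ` Y))" if "y \<in> Y" for y
  proof -
    have "N y \<le> Max (N ` Y)" using assms(2) that by simp
    then have "C + null_tail a (Max (N ` Y)) \<subseteq> C + null_tail a (N y)"
      by (intro set_plus_mono2 null_tail_antimono) auto
    then show ?thesis using N[OF that] by blast
  qed
  then show ?thesis by blast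
qed

text \<open>Either some letter comes from the tail starting at \<open>N\<close>, and dropping it
  shortens the word, or all letters have index below \<open>N\<close>, which leaves finitely many
  words for \<open>Q\<close>.\<close>

lemma word_ball_Suc_split:
  "\<exists>Q. finite Q \<and> (\<forall>x\<in>word_ball a (Suc n). x \<in> Q \<or> (\<exists>c\<in>null_tail a N. x - c \<in> word_ball a n))"
proof (induction n)
  case 0
  show ?case
    using null_tail_0_split[of a N]
    by (intro exI[of _ "a ` {..<N} \<union> uminus ` a ` {..<N}"]) (auto simp: tail_sums_Suc)
next
  case (Suc n)
  then obtain Q where Q: "finite Q"
    "\<And>x. x \<in> word_ball a (Suc n) \<Longrightarrow> x \<in> Q \<or> (\<exists>c\<in>null_tail a N. x - c \<in> word_ball a n)"
    by blast
  let ?F = "a ` {..<N} \<union> uminus ` a ` {..<N}"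
  show ?case
  proof (intro exI[of _ "Q + ?F"] conjI ballI)
    show "finite (Q + ?F)" using Q(1) by (intro finite_set_plus) auto
    fix z assume "z \<in> word_ball a (Suc (Suc n))"
    then obtain x y where z: "x \<in> word_ball a (Suc n)" "y \<in> null_tail a 0" "z = x + y"
      by (rule tail_sums_SucE)
    show "z \<in> Q + ?F \<or> (\<exists>c\<in>null_tail a N. z - c \<in> word_ball a (Suc n))"
    proof (cases "y \<in> null_tail a N")
      case True
      then show ?thesis using z by (intro disjI2 bexI[of _ y]) auto
    next
      case False
      then have y: "y \<in> ?F" using null_tail_0_split[of a N] z(2) by blast
      from Q(2)[OF z(1)] show ?thesis
      proof
        assume "x \<in> Q"
        then show ?thesis using y z(3) by blast
      next
        assume "\<exists>c\<in>null_tail a N. x - c \<in> word_ball a n"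
        then obtain c where c: "c \<in> null_tail a N" "x - c \<in> word_ball a n" by blast
        then have "(x - c) + y \<in> word_ball a (Suc n)" using z(2) by (intro tail_sums_SucI)
        then show ?thesis using c(1) z(3) by (intro disjI2 bexI[of _ c]) (auto simp: algebra_simps)
      qed
    qed
  qed
qed

lemma finite_fibre:
  assumes "y \<noteq> 0"
  shows "\<exists>N. \<forall>m\<ge>N. a m \<noteq> y"
proof -
  have "openin T (- {y})"
    using Hausdorff closedin_Hausdorff_singleton[of T y] by (simp add: closedin_def Compl_eq_Diff_UNIV)
  then have "\<forall>\<^sub>F m in sequentially. a m \<in> - {y}"
    using lim assms unfolding limitin_def by blast
  then show ?thesis by (simp add: eventually_sequentially)
qed

text \<open>If \<open>s + a m\<close> is a word of length \<open>n + 1\<close> with a letter far out in the sequence, then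
  moving that letter to the left puts \<open>s\<close> into the closed set \<open>word_ball a n\<close> up to a small
  error. Otherwise \<open>s + a m\<close> lies in a finite set, which is possible only for few \<open>m\<close>.\<close>

lemma eventually_add_notin_word_ball:
  assumes "s \<notin> word_ball a n"
  shows "\<exists>N. \<forall>m\<ge>N. a m \<noteq> 0 \<longrightarrow> s + a m \<notin> word_ball a (Suc n)"
proof -
  \<comment> \<open>The first tail will absorb the letter that is split off, the second one the
    letter \<open>- a m\<close>.\<close>
  obtain N1 where N1: "s \<notin> word_ball a n + null_tail a N1"
    using avoid_null_tail[OF compactin_tail_sums assms] by blast
  then obtain N2 where N2: "s \<notin> (word_ball a n + null_tail a N1) + null_tail a N2"
    using avoid_null_tail[OF compactin_set_plus[OF compactin_tail_sums compactin_null_tail]] by blast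
  obtain Q where Q: "finite Q"
    "\<And>x. x \<in> word_ball a (Suc n) \<Longrightarrow> x \<in> Q \<or> (\<exists>c\<in>null_tail a N1. x - c \<in> word_ball a n)"
    using word_ball_Suc_split[of n N1] by blast
  \<comment> \<open>For \<open>q \<noteq> s\<close> the equation \<open>s + a m = q\<close> fails
    for all large \<open>m\<close>; for \<open>q = s\<close> it would force
    \<open>a m = 0\<close>.\<close>
  have "\<forall>q. \<exists>N. q \<noteq> s \<longrightarrow> (\<forall>m\<ge>N. a m \<noteq> q - s)"
    using finite_fibre by (metis eq_iff_diff_eq_0)
  then obtain N where N: "\<And>q m. q \<noteq> s \<Longrightarrow> m \<ge> N q \<Longrightarrow> a m \<noteq> q - s" by metis
  show ?thesis
  proof (intro exI[of _ "Max (insert N2 (N ` Q))"] allI impI notI)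
    fix m assume m: "Max (insert N2 (N ` Q)) \<le> m" "a m \<noteq> 0"
      and *: "s + a m \<in> word_ball a (Suc n)"
    have "N2 \<le> m" and NQ: "\<And>q. q \<in> Q \<Longrightarrow> N q \<le> m" using m(1) Q(1) by auto
    from Q(2)[OF *] show False
    proof
      assume "s + a m \<in> Q"
      then show False using N[OF _ NQ, of "s + a m"] m(2) by simp
    next
      assume "\<exists>c\<in>null_tail a N1. s + a m - c \<in> word_ball a n"
      then obtain c where c: "c \<in> null_tail a N1" "s + a m - c \<in> word_ball a n" by blast
      have "- a m \<in> null_tail a N2" using \<open>N2 \<le> m\<close> by (simp add: null_tail_def)
      then have "((s + a m - c) + c) + (- a m) \<in> (word_ball a n + null_tail a N1) + null_tail a N2"
        using c by blast
      then show False using N2 by simp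
    qed
  qed
qed

text \<open>Finitely many pairs \<open>(s, n)\<close> impose finitely many bounds, and some nonzero
  term lies beyond all of them. The claim for \<open>s - a m\<close> is that for
  \<open>- s + a m\<close>, by symmetry of word balls.\<close>

lemma exists_lengthening:
  assumes "finite C" "infinite {n. a n \<noteq> 0}"
  shows "\<exists>m. a m \<noteq> 0 \<and> (\<forall>s\<in>C. \<forall>n\<le>k. s \<notin> word_ball a n \<longrightarrow>
      s + a m \<notin> word_ball a (Suc n) \<and> s - a m \<notin> word_ball a (Suc n))"
proof -
  let ?D = "C \<union> uminus ` C"
  have "\<forall>p. \<exists>N. fst p \<notin> word_ball a (snd p) \<longrightarrow>
      (\<forall>m\<ge>N. a m \<noteq> 0 \<longrightarrow> fst p + a m \<notin> word_ball a (Suc (snd p)))"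
    using eventually_add_notin_word_ball by blast
  then obtain N where N: "\<And>s n m. s \<notin> word_ball a n \<Longrightarrow> m \<ge> N (s, n) \<Longrightarrow> a m \<noteq> 0 \<Longrightarrow>
      s + a m \<notin> word_ball a (Suc n)"
    by (metis fst_conv snd_conv)
  let ?P = "?D \<times> {..k}"
  obtain m where m: "Max (insert 0 (N ` ?P)) < m" "a m \<noteq> 0"
    using assms(2) unfolding infinite_nat_iff_unbounded by blast
  have *: "s + a m \<notin> word_ball a (Suc n)" if "s \<in> ?D" "n \<le> k" "s \<notin> word_ball a n" for s n
  proof (rule N[OF that(3) _ m(2)])
    have "N (s, n) \<le> Max (insert 0 (N ` ?P))" using assms(1) that by (intro Max_ge) auto
    then show "N (s, n) \<le> m" using m(1) by simp
  qed
  have "s - a m \<notin> word_ball a (Suc n)" if "s \<in> C" "n \<le> k" "s \<notin> word_ball a n" for s n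
    using *[of "- s" n] that uminus_tail_sums[of "s - a m" a "\<lambda>_. 0" "Suc n"] by simp
  with * m(2) show ?thesis by blast
qed

text \<open>Greedy choice: each new term lengthens all signed sums of the earlier ones. The sets
  \<open>F\<close> and \<open>H\<close> carry the positive and the negative signs.\<close>

lemma exists_independent_subsequence:
  assumes "infinite {n. a n \<noteq> 0}"
  obtains b :: "nat \<Rightarrow> 'a" where "range b \<subseteq> range a"
    and "\<And>F H n. finite F \<Longrightarrow> finite H \<Longrightarrow> F \<inter> H = {} \<Longrightarrow> n < card F + card H \<Longrightarrow>
        sum b F - sum b H \<notin> word_ball a n"
proof -
  define good where "good k C c \<longleftrightarrow> c \<in> range a \<and> c \<noteq> 0 \<and> (\<forall>s\<in>C. \<forall>n\<le>k. s \<notin> word_ball a n \<longrightarrow>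
      s + c \<notin> word_ball a (Suc n) \<and> s - c \<notin> word_ball a (Suc n))" for k C c
  have ex: "\<exists>c. good k C c" if "finite C" for k C
    using exists_lengthening[OF that assms, of k] unfolding good_def by blast
  \<comment> \<open>\<open>fst (p k)\<close> is a finite set containing the signed sums of the first
    \<open>k\<close> terms, and \<open>snd (p k)\<close> is the next term. Radii up to
    \<open>k\<close> suffice, as such sums have at most \<open>k\<close> letters.\<close>
  have "\<exists>p. \<forall>k. (finite (fst (p k)) \<and> 0 \<in> fst (p k) \<and> good k (fst (p k)) (snd (p k))) \<and>
      (fst (p (Suc k)) = fst (p k) \<union> (fst (p k) + {snd (p k), - snd (p k)}))"
  proof (rule dependent_nat_choice)
    show "\<exists>p. finite (fst p) \<and> 0 \<in> fst p \<and> good 0 (fst p) (snd p)"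
      using ex[of "{0}" 0] by auto
    fix p k assume "finite (fst p) \<and> 0 \<in> fst p \<and> good k (fst p) (snd p)"
    moreover from this have "finite (fst p \<union> (fst p + {snd p, - snd p}))" by (auto intro: finite_set_plus)
    ultimately show "\<exists>q. (finite (fst q) \<and> 0 \<in> fst q \<and> good (Suc k) (fst q) (snd q)) \<and>
        fst q = fst p \<union> (fst p + {snd p, - snd p})"
      using ex[of "fst p \<union> (fst p + {snd p, - snd p})" "Suc k"] by auto
  qed
  then obtain p where p: "\<And>k. good k (fst (p k)) (snd (p k))" "\<And>k. 0 \<in> fst (p k)"
    "\<And>k. fst (p (Suc k)) = fst (p k) \<union> (fst (p k) + {snd (p k), - snd (p k)})" by blast
  define C b where "C k = fst (p k)" and "b k = snd (p k)" for k
  have good: "good k (C k) (b k)" and zero: "0 \<in> C k" for k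
    using p by (auto simp: C_def b_def)
  have CSuc: "s \<in> C (Suc k)" "s + b k \<in> C (Suc k)" "s - b k \<in> C (Suc k)" if "s \<in> C k" for s k
  proof -
    have "s + b k \<in> C k + {b k, - b k}" "s + - b k \<in> C k + {b k, - b k}" using that by blast+
    then show "s \<in> C (Suc k)" "s + b k \<in> C (Suc k)" "s - b k \<in> C (Suc k)"
      using that p(3)[of k] by (simp_all add: C_def b_def)
  qed
  \<comment> \<open>Every ball of radius below \<open>r\<close> misses \<open>s\<close>. For
    \<open>r = 0\<close> there is no such ball to start from, and \<open>s = 0\<close> with
    \<open>b k \<noteq> 0\<close> is used instead.\<close>
  have step: "s + b k \<notin> word_ball a n \<and> s - b k \<notin> word_ball a n"
    if s: "s \<in> C k" and r: "\<And>n. n < r \<Longrightarrow> s \<notin> word_ball a n" "r = 0 \<Longrightarrow> s = 0" "r \<le> k" "n < Suc r"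
    for s k r n
  proof (cases "r = 0")
    case True
    then show ?thesis using r(2,4) good[of k] by (simp add: good_def)
  next
    case False
    then have "s \<notin> word_ball a (r - 1)" using r(1) by simp
    then have "s + b k \<notin> word_ball a r" "s - b k \<notin> word_ball a r"
      using good[of k] s r(3) False unfolding good_def by (metis Suc_diff_1 diff_le_self le_trans neq0_conv)+
    then show ?thesis using tail_sums_mono[of n r a "\<lambda>_. 0"] r(4) by auto
  qed
  have main: "sum b F - sum b H \<in> C k \<and> (\<forall>n<card F + card H. sum b F - sum b H \<notin> word_ball a n)"
    if "F \<subseteq> {..<k}" "H \<subseteq> {..<k}" "F \<inter> H = {}" for F H k
    using that
  proof (induction k arbitrary: F H)
    case 0
    then show ?case using zero by simp
  next
    case (Suc k)
    let ?F = "F - {k}" and ?H = "H - {k}"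
    let ?s = "sum b ?F - sum b ?H" and ?r = "card ?F + card ?H"
    have fin: "finite F" "finite H" using Suc.prems by (auto intro: finite_subset)
    have sub: "?F \<subseteq> {..<k}" "?H \<subseteq> {..<k}" using Suc.prems by auto
    have IH: "?s \<in> C k" "\<And>n. n < ?r \<Longrightarrow> ?s \<notin> word_ball a n"
      using Suc.IH[OF sub] Suc.prems(3) by auto
    have "?r = card (?F \<union> ?H)" using fin Suc.prems(3) by (intro card_Un_disjoint[symmetric]) auto
    also have "\<dots> \<le> card {..<k}" using sub by (intro card_mono) auto
    finally have r: "?r \<le> k" by simp
    have r0: "?s = 0" if "?r = 0"
    proof -
      have "?F = {}" "?H = {}" using that fin card_eq_0_iff[of ?F] card_eq_0_iff[of ?H] by auto
      then show ?thesis by (simp only: sum.empty diff_zero)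
    qed
    note step = step[OF IH r0 r]
    consider "k \<in> F" "k \<notin> H" | "k \<in> H" "k \<notin> F" | "k \<notin> F" "k \<notin> H" using Suc.prems(3) by blast
    then show ?case
    proof cases
      case 1
      then have "sum b F - sum b H = ?s + b k" "card F + card H = Suc ?r"
        using fin sum.remove[of F k b] card.remove[of F k] by (auto simp del: card_Diff_singleton)
      then show ?thesis using step CSuc(2)[OF IH(1)] by auto
    next
      case 2
      then have "sum b F - sum b H = ?s - b k" "card F + card H = Suc ?r"
        using fin sum.remove[of H k b] card.remove[of H k] by (auto simp del: card_Diff_singleton)
      then show ?thesis using step CSuc(3)[OF IH(1)] by auto
    next
      case 3
      then show ?thesis using IH CSuc(1)[OF IH(1)] by auto
    qed
  qed
  show ?thesis
  proof (rule that[of b])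
    show "range b \<subseteq> range a" using good by (auto simp: good_def)
    fix F H :: "nat set" and n
    assume FH: "finite F" "finite H" "F \<inter> H = {}" "n < card F + card H"
    then obtain k where "F \<union> H \<subseteq> {..<k}" using finite_nat_iff_bounded[of "F \<union> H"] by auto
    then show "sum b F - sum b H \<notin> word_ball a n" using main[of F k H] FH by auto
  qed
qed

end

section \<open>Boundedness of word length on compact sets\<close>

context null_sequence
begin

text \<open>Finitely many translates of \<open>W\<close> cover \<open>K\<close>, so by the
  pigeonhole principle two terms share a translate, the one by \<open>c\<close>.\<close>

lemma compactin_close_pair:
  fixes x :: "nat \<Rightarrow> 'a"
  assumes K: "compactin T K" "range x \<subseteq> K" and W: "openin T W" "0 \<in> W"
  obtains j k c where "j < k" "x j - c \<in> W" "x k - c \<in> W"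
proof -
  define V where "V c = {y. y - c \<in> W}" for c
  have "openin T U" if "U \<in> range V" for U
    using openin_translation[OF W(1)] that by (auto simp: V_def)
  moreover have "x \<in> V x" for x using W(2) by (simp add: V_def)
  then have "K \<subseteq> \<Union> (range V)" by blast
  ultimately obtain \<F> where \<F>: "finite \<F>" "\<F> \<subseteq> range V" "K \<subseteq> \<Union>\<F>"
    using compactinD[OF K(1), of "range V"] by metis
  then obtain C where "finite C" "\<F> = V ` C" by (meson finite_subset_image)
  then have "\<forall>k. \<exists>c\<in>C. x k \<in> V c" using \<F>(3) K(2) by blast
  then obtain c where c: "\<And>k. c k \<in> C" "\<And>k. x k \<in> V (c k)" by metis
  have "finite (range c)" using c(1) \<open>finite C\<close> by (auto intro: finite_subset)
  then have "\<not> inj c" using finite_imageD infinite_UNIV_nat by blast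
  then obtain j k where "j < k" "c j = c k" by (metis injI linorder_neqE_nat)
  then show ?thesis using that[of j k "c j"] c(2)[of j] c(2)[of k] by (simp add: V_def)
qed

text \<open>The indices \<open>\<nu> i\<close> are chosen one after the other. At stage \<open>i\<close> the differences with
  \<open>k > i\<close> need no attention, as they have length exceeding \<open>i\<close>.\<close>

lemma exists_avoiding_tail_sums:
  assumes long: "\<And>j k. j < k \<Longrightarrow> x k - x j \<notin> word_ball a k"
  shows "\<exists>\<nu>. \<forall>j k i. j < k \<longrightarrow> x k - x j \<notin> tail_sums a \<nu> i"
proof -
  define Y where "Y i = {x k - x j | j k. j < k \<and> k \<le> i}" for i
  have Y: "finite (Y i)" for i
  proof (rule finite_subset)
    show "Y i \<subseteq> (\<lambda>(k, j). x k - x j) ` ({..i} \<times> {..i})" by (force simp: Y_def)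
  qed simp
  have YI: "x k - x j \<in> Y i" if "j < k" "k \<le> i" for i j k
    using that by (auto simp: Y_def)
  \<comment> \<open>\<open>Z i\<close> stands for \<open>tail_sums a \<nu> i\<close>. Each step
    asserts only that some tail \<open>v\<close> was added, and \<open>\<nu>\<close> is read off
    afterwards.\<close>
  have "\<exists>Z. \<forall>i. (compactin T (Z i) \<and> Z i \<subseteq> word_ball a i \<and> Y i \<inter> Z i = {} \<and> (i = 0 \<longrightarrow> Z i = {0})) \<and>
      (\<exists>v. Z (Suc i) = Z i + null_tail a v)"
  proof (rule dependent_nat_choice)
    show "\<exists>Z. compactin T Z \<and> Z \<subseteq> word_ball a 0 \<and> Y 0 \<inter> Z = {} \<and> ((0::nat) = 0 \<longrightarrow> Z = {0})"
      by (auto simp: Y_def)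
    fix Z and i :: nat
    assume Z: "compactin T Z \<and> Z \<subseteq> word_ball a i \<and> Y i \<inter> Z = {} \<and> (i = 0 \<longrightarrow> Z = {0})"
    then have "\<exists>v. Y i \<inter> (Z + null_tail a v) = {}"
      by (intro avoid_null_tail_finite Y) auto
    then obtain v where v: "Y i \<inter> (Z + null_tail a v) = {}" ..
    have sub: "Z + null_tail a v \<subseteq> word_ball a (Suc i)"
      unfolding tail_sums_Suc using Z by (intro set_plus_mono2 null_tail_antimono) auto
    \<comment> \<open>The new differences are those with \<open>k = Suc i\<close>; by
      \<open>long\<close> they are too long to lie in the enlarged set.\<close>
    have "y \<notin> Z + null_tail a v" if y: "y \<in> Y (Suc i)" for y
    proof -
      obtain j k where jk: "j < k" "k \<le> Suc i" "y = x k - x j" using y by (auto simp: Y_def)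
      show ?thesis
      proof (cases "k = Suc i")
        case True
        then show ?thesis using long[OF jk(1)] sub jk(3) by blast
      next
        case False
        then show ?thesis using YI[of j k i] v jk by auto
      qed
    qed
    then show "\<exists>Z'. (compactin T Z' \<and> Z' \<subseteq> word_ball a (Suc i) \<and> Y (Suc i) \<inter> Z' = {} \<and>
        (Suc i = 0 \<longrightarrow> Z' = {0})) \<and> (\<exists>v. Z' = Z + null_tail a v)"
      using Z sub compactin_set_plus[OF _ compactin_null_tail]
      by (intro exI[of _ "Z + null_tail a v"]) auto
  qed
  then obtain Z \<nu> where Z: "\<And>i. Z i \<subseteq> word_ball a i" "\<And>i. Y i \<inter> Z i = {}" "Z 0 = {0}"
    and \<nu>: "\<And>i. Z (Suc i) = Z i + null_tail a (\<nu> i)" by metis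
  have Z_eq: "Z i = tail_sums a \<nu> i" for i
    by (induction i) (simp_all add: Z(3) \<nu> tail_sums_Suc)
  show ?thesis
  proof (intro exI[of _ \<nu>] allI impI, fold Z_eq)
    fix j k i :: nat assume "j < k"
    show "x k - x j \<notin> Z i"
    proof (cases "k \<le> i")
      case True
      then show ?thesis using YI[OF \<open>j < k\<close>] Z(2) by blast
    next
      case False
      then have "Z i \<subseteq> word_ball a k" using Z(1)[of i] tail_sums_mono[of i k a "\<lambda>_. 0"] by auto
      then show ?thesis using long[OF \<open>j < k\<close>] by blast
    qed
  qed
qed

end

lemma null_sequence_seq_topology:
  assumes "T_sequence a"
  shows "null_sequence (seq_topology a) a"
  using seq_topology[of a] Hausdorff_seq_topology[OF assms]
  by unfold_locales (auto simp: strongest_group_topology_def)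

text \<open>The strength of the topology enters here through \<open>UN_tail_sums_nhd\<close>:
  unbounded length would give a sequence in \<open>K\<close> whose differences all avoid a
  neighbourhood of zero, against compactness.\<close>

lemma compactin_bounded_word_length:
  assumes a: "T_sequence a" and K: "compactin (seq_topology a) K"
  shows "\<exists>n. K \<inter> (\<Union>m. word_ball a m) \<subseteq> word_ball a n"
proof (rule ccontr)
  interpret null_sequence "seq_topology a" a by (rule null_sequence_seq_topology[OF a])
  assume "\<nexists>n. K \<inter> (\<Union>m. word_ball a m) \<subseteq> word_ball a n"
  then have ex: "\<exists>x m. x \<in> K \<and> x \<in> word_ball a m \<and> x \<notin> word_ball a n" for n by blast
  \<comment> \<open>\<open>p k\<close> pairs a point of \<open>K\<close> with a bound on its word
    length. Avoiding radius \<open>Suc k + snd (p k)\<close> keeps the difference from every earlier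
    point outside the ball of radius \<open>Suc k\<close>.\<close>
  have "\<exists>p. \<forall>k. (fst (p k) \<in> K \<and> fst (p k) \<in> word_ball a (snd (p k))) \<and>
      (snd (p k) \<le> snd (p (Suc k)) \<and> fst (p (Suc k)) \<notin> word_ball a (Suc k + snd (p k)))"
  proof (rule dependent_nat_choice)
    show "\<exists>p. fst p \<in> K \<and> fst p \<in> word_ball a (snd p)" using ex[of 0] by auto
    fix p :: "'a \<times> nat" and k
    obtain y m where y: "y \<in> K" "y \<in> word_ball a m" "y \<notin> word_ball a (Suc k + snd p)"
      using ex by blast
    then have "y \<in> word_ball a (max m (snd p))"
      using tail_sums_mono[of m "max m (snd p)" a "\<lambda>_. 0"] by auto
    then show "\<exists>q. (fst q \<in> K \<and> fst q \<in> word_ball a (snd q)) \<and>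
        (snd p \<le> snd q \<and> fst q \<notin> word_ball a (Suc k + snd p))"
      using y by (intro exI[of _ "(y, max m (snd p))"]) auto
  qed
  then obtain p where "\<forall>k. (fst (p k) \<in> K \<and> fst (p k) \<in> word_ball a (snd (p k))) \<and>
      (snd (p k) \<le> snd (p (Suc k)) \<and> fst (p (Suc k)) \<notin> word_ball a (Suc k + snd (p k)))" ..
  then have p: "\<And>k. fst (p k) \<in> K" "\<And>k. fst (p k) \<in> word_ball a (snd (p k))"
    "\<And>k. snd (p k) \<le> snd (p (Suc k))" "\<And>k. fst (p (Suc k)) \<notin> word_ball a (Suc k + snd (p k))"
    by simp_all
  define x where "x k = fst (p k)" for k
  have "x k - x j \<notin> word_ball a k" if jk: "j < k" for j k
  proof
    assume *: "x k - x j \<in> word_ball a k"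
    obtain l where l: "k = Suc l" "j \<le> l" using jk by (cases k) auto
    have "snd (p j) \<le> snd (p l)" using lift_Suc_mono_le[of "\<lambda>k. snd (p k)"] p(3) l(2) by blast
    then have "x j \<in> word_ball a (snd (p l))"
      using p(2)[of j] tail_sums_mono[of _ _ a "\<lambda>_. 0"] by (auto simp: x_def)
    from word_ball_addI[OF * this] show False using p(4)[of l] l(1) by (simp add: x_def)
  qed
  then obtain \<nu> where \<nu>: "\<And>j k i. j < k \<Longrightarrow> x k - x j \<notin> tail_sums a \<nu> i"
    using exists_avoiding_tail_sums[of x] by metis
  \<comment> \<open>A halved neighbourhood is taken because the two points are each compared with
    \<open>c\<close>, so their difference is a sum of two of its elements.\<close>
  obtain \<nu>' where \<nu>': "(\<Union>k. tail_sums a \<nu>' k) + (\<Union>k. tail_sums a \<nu>' k) \<subseteq> (\<Union>k. tail_sums a \<nu> k)"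
    using UN_tail_sums_add by blast
  obtain W where W: "openin (seq_topology a) W" "0 \<in> W" "W \<subseteq> (\<Union>k. tail_sums a \<nu>' k)"
    using UN_tail_sums_nhd by blast
  obtain j k c where jk: "j < k" "x j - c \<in> W" "x k - c \<in> W"
    by (rule compactin_close_pair[OF K _ W(1,2), of x]) (use p(1) in \<open>auto simp: x_def\<close>)
  then have "x k - c \<in> (\<Union>k. tail_sums a \<nu>' k)" "- (x j - c) \<in> (\<Union>k. tail_sums a \<nu>' k)"
    using W(3) uminus_tail_sums[of "x j - c" a \<nu>'] by (blast, auto)
  then have "(x k - c) + (- (x j - c)) \<in> (\<Union>k. tail_sums a \<nu> k)" using \<nu>' by blast
  then show False using \<nu>[OF jk(1)] by simp
qed

section \<open>The embedded Hamming space\<close>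

lemma sum_diff_sum:
  fixes b :: "'i \<Rightarrow> 'a::ab_group_add"
  assumes "finite F" "finite H"
  shows "sum b F - sum b H = sum b (F - H) - sum b (H - F)"
  using assms sum.Int_Diff[of F b H] sum.Int_Diff[of H b F] by (simp add: Int_commute)

lemma hamming_dist_eq:
  assumes "finite F" "finite H"
  shows "hamming_dist F H = card (F - H) + card (H - F)"
  unfolding hamming_dist_def using assms by (intro card_Un_disjoint) auto

theorem theorem3:
  fixes a :: "nat \<Rightarrow> 'a::ab_group_add"
  assumes "T_sequence a"
    and "\<not> trivial_seq a"
  shows "(\<exists>Y. asymorphic Y (subspace_coarse (ideal_coarse (seq_ideal a)) Y)
                hamming_space hamming_coarse) \<and>
         asdim UNIV (ideal_coarse (seq_ideal a)) = \<infinity>"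
proof -
  interpret null_sequence "seq_topology a" a by (rule null_sequence_seq_topology[OF assms(1)])
  have "infinite {n. a n \<noteq> 0}" using assms(2) by (simp add: trivial_seq_def)
  then obtain b :: "nat \<Rightarrow> 'a" where b: "range b \<subseteq> range a"
    "\<And>F H n. finite F \<Longrightarrow> finite H \<Longrightarrow> F \<inter> H = {} \<Longrightarrow> n < card F + card H \<Longrightarrow>
      sum b F - sum b H \<notin> word_ball a n"
    using exists_independent_subsequence by metis
  have b0: "b i \<in> null_tail a 0" for i using b(1) by (auto simp: null_tail_def)
  define f where "f F = sum b F" for F
  let ?\<E> = "ideal_coarse (seq_ideal a)"

  \<comment> \<open>Hamming distance as word length\<close>
  have f_le: "f F - f H \<in> word_ball a n" if "finite F" "finite H" "hamming_dist F H \<le> n" for F H n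
  proof -
    have "f F - f H \<in> word_ball a (hamming_dist F H)"
      unfolding f_def sum_diff_sum[OF that(1,2)] hamming_dist_eq[OF that(1,2)]
      using that(1,2) b0 by (intro word_ball_diffI sum_word_ball) auto
    then show ?thesis using tail_sums_mono[OF that(3), of a "\<lambda>_. 0"] by blast
  qed
  \<comment> \<open>This is the contrapositive of the choice of \<open>b\<close>, for the disjoint
    sets \<open>F - H\<close> and \<open>H - F\<close>.\<close>
  have f_ge: "hamming_dist F H \<le> n" if "finite F" "finite H" "f F - f H \<in> word_ball a n" for F H n
    using b(2)[of "F - H" "H - F" n] that(3) that(1,2)
    by (force simp: f_def sum_diff_sum[OF that(1,2)] hamming_dist_eq[OF that(1,2)] not_less)
  have "inj_on f hamming_space"
  proof (rule inj_onI)
    fix F H assume "F \<in> hamming_space" "H \<in> hamming_space" "f F = f H"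
    then have "hamming_dist F H \<le> 0" "finite F" "finite H"
      using f_ge[of F H 0] by (auto simp: hamming_space_def)
    then show "F = H" by (auto simp: hamming_dist_def)
  qed

  \<comment> \<open>Word balls are compact, hence equal to their closures in a Hausdorff space, and
    so belong to the ideal.\<close>
  have ball_entourage: "{(x, y). x - y \<in> word_ball a n} \<in> ?\<E>" for n
  proof -
    have "closedin (seq_topology a) (word_ball a n)"
      using compactin_tail_sums Hausdorff by (simp add: compactin_imp_closedin)
    then have "word_ball a n \<in> seq_ideal a"
      using compactin_tail_sums by (simp add: seq_ideal_def precompact_in_def closure_of_closedin)
    then have "{(x, y). x - y \<in> word_ball a n} \<in> ideal_base (seq_ideal a)"
      unfolding ideal_base_def using zero_tail_sums by blast
    then show ?thesis
      using ideal_coarse_structure(2)[OF assms(1)] by (auto simp: is_coarse_base_def)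
  qed
  have entourage_bounded:
    "\<exists>n. \<forall>F H. finite F \<longrightarrow> finite H \<longrightarrow> (f F, f H) \<in> E \<longrightarrow> hamming_dist F H \<le> n" if E: "E \<in> ?\<E>" for E
  proof -
    obtain B where "B \<in> ideal_base (seq_ideal a)" "E \<subseteq> B"
      using E ideal_coarse_structure(2)[OF assms(1)] by (auto simp: is_coarse_base_def)
    then obtain P where P: "P \<in> seq_ideal a" "E \<subseteq> {(x, y). x - y \<in> P}"
      by (auto simp: ideal_base_def)
    let ?K = "seq_topology a closure_of P"
    have "compactin (seq_topology a) ?K" "P \<subseteq> ?K"
      using P(1) by (auto simp: seq_ideal_def precompact_in_def closure_of_subset)
    then obtain n where n: "P \<inter> (\<Union>m. word_ball a m) \<subseteq> word_ball a n"
      using compactin_bounded_word_length[OF assms(1)] by blast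
    \<comment> \<open>By \<open>f_le\<close> the difference is a word, so it lies in the part of
      \<open>P\<close> where length is bounded by \<open>n\<close>.\<close>
    have "hamming_dist F H \<le> n" if "finite F" "finite H" "(f F, f H) \<in> E" for F H
      using f_ge[OF that(1,2)] f_le[OF that(1,2) le_refl] that(3) P(2) n by blast
    then show ?thesis by blast
  qed

  \<comment> \<open>Asymorphism between the image and the Hamming space\<close>
  define Y where "Y = f ` hamming_space"
  define g where "g = inv_into hamming_space f"
  have bij_f: "bij_betw f hamming_space Y"
    using \<open>inj_on f hamming_space\<close> by (simp add: Y_def bij_betw_def)
  then have bij_g: "bij_betw g Y hamming_space" by (simp add: g_def bij_betw_inv_into)
  have gf: "g (f F) = F" if "F \<in> hamming_space" for F
    using that \<open>inj_on f hamming_space\<close> by (simp add: g_def)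
  have inv_g: "inv_into Y g F = f F" if "F \<in> hamming_space" for F
    using that bij_g gf by (metis Y_def bij_betw_inv_into_left imageI)
  have "macro_uniform Y (subspace_coarse ?\<E> Y) hamming_space hamming_coarse g"
    unfolding macro_uniform_def
  proof (intro conjI ballI)
    show "g \<in> Y \<rightarrow> hamming_space" using bij_g by (auto simp: bij_betw_def)
    fix E' assume "E' \<in> subspace_coarse ?\<E> Y"
    then obtain E where E: "E \<in> ?\<E>" "E' = E \<inter> (Y \<times> Y)" by (auto simp: subspace_coarse_def)
    from entourage_bounded[OF E(1)] obtain n where n:
      "\<And>F H. finite F \<Longrightarrow> finite H \<Longrightarrow> (f F, f H) \<in> E \<Longrightarrow> hamming_dist F H \<le> n" by blast
    let ?B = "{(F, H). F \<in> hamming_space \<and> H \<in> hamming_space \<and> hamming_dist F H \<le> n}"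
    have "?B \<in> hamming_coarse"
      using hamming_coarse_structure(2) unfolding is_coarse_base_def hamming_base_def by blast
    moreover have "\<forall>x\<in>Y. g ` (E' `` {x}) \<subseteq> ?B `` {g x}"
      using n by (auto simp: E(2) Y_def gf) (auto simp: hamming_space_def)
    ultimately show "\<exists>D\<in>hamming_coarse. \<forall>x\<in>Y. g ` (E' `` {x}) \<subseteq> D `` {g x}" by blast
  qed
  moreover have "macro_uniform hamming_space hamming_coarse Y (subspace_coarse ?\<E> Y) (inv_into Y g)"
    unfolding macro_uniform_def
  proof (intro conjI ballI)
    show "inv_into Y g \<in> hamming_space \<rightarrow> Y" using inv_g by (auto simp: Y_def)
    fix E assume "E \<in> hamming_coarse"
    then obtain n where E:
      "E \<subseteq> {(F, H). F \<in> hamming_space \<and> H \<in> hamming_space \<and> hamming_dist F H \<le> n}"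
      using hamming_coarse_structure(2) unfolding is_coarse_base_def hamming_base_def by blast
    let ?D = "{(x, y). x - y \<in> word_ball a n} \<inter> (Y \<times> Y)"
    have "?D \<in> subspace_coarse ?\<E> Y"
      using ball_entourage by (auto simp: subspace_coarse_def)
    moreover have "\<forall>F\<in>hamming_space. inv_into Y g ` (E `` {F}) \<subseteq> ?D `` {inv_into Y g F}"
    proof (intro ballI subsetI)
      fix F z assume F: "F \<in> hamming_space" and "z \<in> inv_into Y g ` (E `` {F})"
      then obtain H where H: "H \<in> hamming_space" "hamming_dist F H \<le> n" "z = f H"
        using E inv_g by auto
      then have "f F - f H \<in> word_ball a n" using F f_le by (simp add: hamming_space_def)
      then show "z \<in> ?D `` {inv_into Y g F}" using F H inv_g by (auto simp: Y_def)
    qed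
    ultimately show "\<exists>D\<in>subspace_coarse ?\<E> Y. \<forall>F\<in>hamming_space.
        inv_into Y g ` (E `` {F}) \<subseteq> D `` {inv_into Y g F}" by blast
  qed
  ultimately have "asymorphic Y (subspace_coarse ?\<E> Y) hamming_space hamming_coarse"
    using bij_g by (auto simp: asymorphic_def asymorphism_def)

  \<comment> \<open>Infinite asymptotic dimension\<close>
  moreover have "\<not> asdim_le UNIV ?\<E> N" for N
  proof
    \<comment> \<open>Radius 2 allows for the exchange of one element of a finite set.\<close>
    let ?E = "{(x, y). x - y \<in> word_ball a 2}"
    assume "asdim_le UNIV ?\<E> N"
    then have "\<exists>D\<in>?\<E>. \<exists>\<U> :: nat \<Rightarrow> 'a set set. (\<Union>i\<le>N. \<Union>(\<U> i)) = UNIV \<and>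
        (\<forall>i\<le>N. \<forall>U\<in>\<U> i. U \<times> U \<subseteq> D) \<and>
        (\<forall>i\<le>N. \<forall>U\<in>\<U> i. \<forall>V\<in>\<U> i. U \<noteq> V \<longrightarrow> (U \<times> V) \<inter> ?E = {})"
      unfolding asdim_le_def using ball_entourage[of 2] by (rule bspec)
    then obtain D \<U> where D: "D \<in> ?\<E>" and cover: "(\<Union>i\<le>N. \<Union>(\<U> i)) = UNIV"
      and bdd: "\<forall>i\<le>N. \<forall>U\<in>\<U> i. U \<times> U \<subseteq> D"
      and sep: "\<forall>i\<le>N. \<forall>U\<in>\<U> i. \<forall>V\<in>\<U> i. U \<noteq> V \<longrightarrow> (U \<times> V) \<inter> ?E = {}"
      by (elim bexE exE conjE) (rule that)
    from entourage_bounded[OF D] obtain n where n: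
      "\<And>F H. finite F \<Longrightarrow> finite H \<Longrightarrow> (f F, f H) \<in> D \<Longrightarrow> hamming_dist F H \<le> n" by blast
    \<comment> \<open>Disjoint sets of size \<open>k\<close> are at distance \<open>k + k\<close>,
      which exceeds \<open>n\<close>.\<close>
    define k where "k = Suc n"
    have "f X \<in> (\<Union>i\<le>N. \<Union>(\<U> i))" for X unfolding cover by simp
    then have "\<forall>X. \<exists>i. i \<in> {..N} \<and> f X \<in> \<Union>(\<U> i)" by (simp only: UN_iff Bex_def) simp
    then obtain colour where "\<forall>X. colour X \<in> {..N} \<and> f X \<in> \<Union>(\<U> (colour X))" by (rule choice[THEN exE])
    then have colour: "\<And>X. colour X \<le> N" "\<And>X. f X \<in> \<Union>(\<U> (colour X))" by simp_all
    \<comment> \<open>The families are numbered from 0 to \<open>N\<close>, which makes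
      \<open>Suc N\<close> colours.\<close>
    obtain M t where M: "infinite M"
      "\<And>X. X \<subseteq> M \<Longrightarrow> finite X \<Longrightarrow> card X = k \<Longrightarrow> colour X = t"
      using Ramsey[of "UNIV :: nat set" k colour "Suc N"] colour(1)
      by (auto simp: less_Suc_eq_le)
    define e where "e = enumerate M"
    have inj: "inj e" using M(1) by (simp add: e_def strict_mono_imp_inj_on strict_mono_enumerate)
    \<comment> \<open>Windows of \<open>k\<close> consecutive elements of \<open>M\<close>: passing
      to the next one replaces \<open>e j\<close> by \<open>e (j + k)\<close>, and after
      \<open>k\<close> steps the window is disjoint from the first.\<close>
    define X where "X j = e ` {j..<j + k}" for j
    have X: "finite (X j)" "card (X j) = k" "X j \<subseteq> M" for j
      using inj M(1) by (auto simp: X_def card_image inj_on_subset e_def enumerate_in_set)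
    have "t \<le> N" using colour(1)[of "X 0"] M(2)[of "X 0"] X by simp
    have "\<exists>U\<in>\<U> t. f (X j) \<in> U" for j using colour(2)[of "X j"] M(2)[of "X j"] X by auto
    then obtain U where U: "\<And>j. U j \<in> \<U> t" "\<And>j. f (X j) \<in> U j" by metis
    \<comment> \<open>Both members belong to the family of colour \<open>t\<close>, where distinct
      members are separated by \<open>?E\<close>, but consecutive windows have images related by
      \<open>?E\<close>.\<close>
    have "U (Suc j) = U j" for j
    proof (rule ccontr)
      assume "U (Suc j) \<noteq> U j"
      have "X j \<subseteq> e ` insert j {Suc j..<Suc j + k}" "X (Suc j) \<subseteq> e ` insert (j + k) {j..<j + k}"
        unfolding X_def by (intro image_mono; auto)+
      then have "X j - X (Suc j) \<subseteq> {e j}" "X (Suc j) - X j \<subseteq> {e (j + k)}"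
        by (auto simp only: X_def image_insert)
      then have "card (X j - X (Suc j)) \<le> 1" "card (X (Suc j) - X j) \<le> 1"
        using card_mono[of "{e j}"] card_mono[of "{e (j + k)}"] by simp_all
      then have "f (X (Suc j)) - f (X j) \<in> word_ball a 2"
        using X(1) by (intro f_le) (simp_all add: hamming_dist_eq)
      then have "(f (X (Suc j)), f (X j)) \<in> (U (Suc j) \<times> U j) \<inter> ?E" using U(2) by simp
      moreover have "(U (Suc j) \<times> U j) \<inter> ?E = {}"
        using sep \<open>t \<le> N\<close> U(1) \<open>U (Suc j) \<noteq> U j\<close> by simp
      ultimately show False by simp
    qed
    then have "U k = U 0" by (induction k) auto
    then have "(f (X 0), f (X k)) \<in> U 0 \<times> U 0" using U(2)[of 0] U(2)[of k] by simp
    moreover have "U 0 \<times> U 0 \<subseteq> D" using bdd \<open>t \<le> N\<close> U(1) by simp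
    ultimately have "(f (X 0), f (X k)) \<in> D" by (rule rev_subsetD)
    then have "hamming_dist (X 0) (X k) \<le> n" using n X(1) by blast
    moreover have "X 0 \<inter> X k = {}" by (simp add: X_def image_Int[OF inj, symmetric])
    then have "hamming_dist (X 0) (X k) = k + k"
      using X(1,2) by (simp add: hamming_dist_eq Diff_triv Int_commute)
    ultimately show False by (simp add: k_def)
  qed
  then have "asdim UNIV ?\<E> = \<infinity>" by (simp add: asdim_def)
  ultimately show ?thesis by blast
qed

end
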